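(* Let $q$ be a real number with $0<q<1$, let $N$ be a positive integer, $e$ a non-negative integer, $r$ a positive integer, and $\boldsymbol{k}=(k_1,\dots,k_r)$ an index of depth $r$. Let $\boldsymbol{k}^{\vee}$ be the Hoffman dual of $\boldsymbol{k}$ and let $s:=\mathrm{dep}(\boldsymbol{k}^{\vee})$. Then $$\sum_{\boldsymbol{e}\in J_{e,r}} b(\boldsymbol{k};\boldsymbol{e})\,H_N^{\star}(\boldsymbol{k}+\boldsymbol{e};q)=\sum_{j=0}^{e} z_N^{\star}(\{1\}^{e-j};q)\sum_{\boldsymbol{e}'\in J_{j,s}} z_N^{\star}(\boldsymbol{k}^{\vee};\boldsymbol{e}';q).$$
   Context: An index is a tuple of positive integers $\boldsymbol{k}=(k_1,\dots,k_r)$; its depth is $\mathrm{dep}(\boldsymbol{k})=r$ and its weight is $k_1+\cdots+k_r$. The empty index is $\varnothing$. $\{a\}^m$ denotes $a,\dots,a$ repeated $m$ times (so $\{1\}^0=\varnothing$). Hoffman dual: every nonempty index can be written uniquely as $\boldsymbol{k}=(\{1\}^{a_1-1},b_1+1,\dots,\{1\}^{a_{t-1}-1},b_{t-1}+1,\{1\}^{a_t-1},b_t)$ with $t\ge 1$ and positive integers $a_1,\dots,a_t,b_1,\dots,b_t$; then $\boldsymbol{k}^{\vee}:=(a_1,\{1\}^{b_1-1},a_2+1,\{1\}^{b_2-1},\dots,a_t+1,\{1\}^{b_t-1})$ (for $t=1$: $\boldsymbol{k}^\vee=(a_1,\{1\}^{b_1-1})$). $J_{e,r}$ is the set of all tuples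 $\boldsymbol{e}=(e_1,\dots,e_r)$ of non-negative integers with $e_1+\cdots+e_r=e$. Sums of tuples of the same length are entrywise. For an index $\boldsymbol{k}=(k_1,\dots,k_r)$ and a tuple of non-negative integers $\boldsymbol{e}=(e_1,\dots,e_r)$, $$b(\boldsymbol{k};\boldsymbol{e}):=\prod_{i=1}^r\binom{k_i+e_i+\delta_{i1}+\delta_{ir}-2}{e_i},$$ where $\delta_{ij}$ is Kronecker's delta, with the convention $\binom{e-1}{e}=1$ if $e=0$ and $0$ if $e>0$. $q$-notation: $[m]_q:=\frac{1-q^m}{1-q}$; $[m]_q!:=\prod_{a=1}^m[a]_q$ with $[0]_q!:=1$; $\binom{N}{m}_q:=\frac{[N]_q!}{[m]_q![N-m]_q!}$ for $0\le m\le N$. Multiple harmonic $q$-sums: $$H_N^{\star}(\boldsymbol{k};q):=\sum_{1\le m_1\le\cdots\le m_r\le N}\frac{q^{(k_1-1)m_1+\cdots+(k_r-1)m_r}}{[m_1]_q^{k_1}\cdots[m_r]_q^{k_r}}\cdot(-1)^{m_r-1}q^{\frac{m_r(m_r+1)}{2}}\binom{N}{m_r}_q,$$ $$z_N^{\star}(\boldsymbol{k};\boldsymbol{e};q):=\sum_{1\le m_1\le\cdots\le m_r\le N}\frac{q^{(e_1+1)m_1+\cdots+(e_r+1)m_r}}{[m_1]_q^{k_1+e_1}\cdots[m_r]_q^{k_r+e_r}},$$ and $z_N^{\star}(\boldsymbol{k};q):=z_N^{\star}(\boldsymbol{k};\{0\}^r;q)$, $z_N^{\star}(\varnothing;q):=1$.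 *)

theory Defs
  imports Complex_Main
begin

definition is_index :: "nat list \<Rightarrow> bool" where
  "is_index k \<longleftrightarrow> (\<forall>x\<in>set k. 0 < x)"

text \<open>A list of pairs \<open>[(a\<^sub>1, b\<^sub>1), \<dots>, (a\<^sub>t, b\<^sub>t)]\<close> of positive integers encodes the index
  \<open>({1}^(a\<^sub>1-1), b\<^sub>1+1, \<dots>, {1}^(a\<^sub>t\<^sub>-\<^sub>1-1), b\<^sub>t\<^sub>-\<^sub>1+1, {1}^(a\<^sub>t-1), b\<^sub>t)\<close>.\<close>

fun index_of_blocks :: "(nat \<times> nat) list \<Rightarrow> nat list" where
  "index_of_blocks [] = []"
| "index_of_blocks [(a, b)] = replicate (a - 1) 1 @ [b]"
| "index_of_blocks ((a, b) # p # ps) = replicate (a - 1) 1 @ [b + 1] @ index_of_blocks (p # ps)"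

fun dual_of_blocks :: "(nat \<times> nat) list \<Rightarrow> nat list" where
  "dual_of_blocks [] = []"
| "dual_of_blocks ((a, b) # ps) =
     a # replicate (b - 1) 1 @ concat (map (\<lambda>(a', b'). (a' + 1) # replicate (b' - 1) 1) ps)"

definition is_blocks :: "(nat \<times> nat) list \<Rightarrow> bool" where
  "is_blocks ps \<longleftrightarrow> ps \<noteq> [] \<and> (\<forall>(a, b)\<in>set ps. 0 < a \<and> 0 < b)"

text \<open>Only meaningful for a nonempty index, where the block decomposition exists and is unique
  (lemma \<open>ex1_blocks\<close> below).\<close>

definition hoffman_dual :: "nat list \<Rightarrow> nat list" where
  "hoffman_dual k = dual_of_blocks (THE ps. is_blocks ps \<and> index_of_blocks ps = k)"

lemma index_of_blocks_one:
  "index_of_blocks ((Suc (Suc a), b) # ps) = 1 # index_of_blocks ((Suc a, b) # ps)"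
  by (cases ps) auto

lemma index_of_blocks_nonempty: "ps \<noteq> [] \<Longrightarrow> index_of_blocks ps \<noteq> []"
  by (induction ps rule: index_of_blocks.induct) auto

lemma ex_blocks:
  assumes "is_index k" "k \<noteq> []"
  shows "\<exists>ps. is_blocks ps \<and> index_of_blocks ps = k"
  using assms
proof (induction k)
  case Nil
  then show ?case by simp
next
  case (Cons x xs)
  have x: "0 < x" using Cons.prems by (simp add: is_index_def)
  show ?case
  proof (cases "xs = []")
    case True
    then show ?thesis
      using x by (intro exI[of _ "[(1, x)]"]) (simp add: is_blocks_def)
  next
    case False
    then obtain ps where ps: "is_blocks ps" "index_of_blocks ps = xs"
      using Cons by (auto simp: is_index_def)
    then obtain a b qs where [simp]: "ps = (a, b) # qs" and ab: "0 < a" "0 < b"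
      by (cases ps) (auto simp: is_blocks_def)
    obtain a' where [simp]: "a = Suc a'" using ab by (cases a) auto
    show ?thesis
    proof (cases "x = 1")
      case True
      then show ?thesis
        using ps by (intro exI[of _ "(Suc a, b) # qs"])
          (auto simp: is_blocks_def index_of_blocks_one simp del: index_of_blocks.simps)
    next
      case False
      then show ?thesis
        using ps x by (intro exI[of _ "(1, x - 1) # ps"]) (auto simp: is_blocks_def)
    qed
  qed
qed

lemma blocks_unique:
  assumes "is_blocks ps" "is_blocks ps'" "index_of_blocks ps = index_of_blocks ps'"
  shows "ps = ps'"
  using assms
proof (induction "index_of_blocks ps" arbitrary: ps ps')
  case Nil
  then show ?case using index_of_blocks_nonempty by (metis is_blocks_def)
next
  case (Cons x xs)
  obtain a b qs where p: "ps = (Suc a, Suc b) # qs" and q: "qs = [] \<or> is_blocks qs"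
    using Cons.prems(1) by (cases ps) (auto simp: is_blocks_def gr0_conv_Suc)
  obtain a' b' qs' where p': "ps' = (Suc a', Suc b') # qs'" and q': "qs' = [] \<or> is_blocks qs'"
    using Cons.prems(2) by (cases ps') (auto simp: is_blocks_def gr0_conv_Suc)
  have eq: "index_of_blocks ((Suc a, Suc b) # qs) = index_of_blocks ((Suc a', Suc b') # qs')"
    using Cons.prems(3) p p' by simp
  show ?case
  proof (cases a; cases a')
    fix c c' assume c: "a = Suc c" "a' = Suc c'"
    have "(Suc c, Suc b) # qs = (Suc c', Suc b') # qs'"
      using Cons.hyps(2) Cons.prems(1,2) eq c p p'
      by (intro Cons.hyps(1)) (auto simp: is_blocks_def index_of_blocks_one simp del: index_of_blocks.simps)
    then show ?thesis using p p' c by simp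
  next
    assume c: "a = 0" "a' = 0"
    show ?thesis
    proof (cases "qs = [] \<or> qs' = []")
      case True
      then show ?thesis using eq p p' c index_of_blocks_nonempty
        by (cases qs; cases qs') (auto dest!: sym[of "[]"])
    next
      case False
      then obtain y ys y' ys' where y: "qs = y # ys" "qs' = y' # ys'"
        by (auto simp: neq_Nil_conv)
      have "qs = qs'"
        using Cons.hyps(2) q q' eq c p y by (intro Cons.hyps(1)) auto
      then show ?thesis using p p' c eq y by simp
    qed
  next
    fix c assume c: "a = Suc c" "a' = 0"
    have "index_of_blocks ((Suc c, Suc b) # qs) \<noteq> []"
      by (rule index_of_blocks_nonempty) simp
    then show ?thesis using eq c
      by (cases qs') (auto simp: index_of_blocks_one simp del: index_of_blocks.simps(3)
            simp add: index_of_blocks.simps(3)[of 1, simplified])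
  next
    fix c assume c: "a = 0" "a' = Suc c"
    have "index_of_blocks ((Suc c, Suc b') # qs') \<noteq> []"
      by (rule index_of_blocks_nonempty) simp
    then show ?thesis using eq c
      by (cases qs) (auto simp: index_of_blocks_one simp del: index_of_blocks.simps(3)
            simp add: index_of_blocks.simps(3)[of 1, simplified])
  qed
qed

lemma ex1_blocks:
  assumes "is_index k" "k \<noteq> []"
  shows "\<exists>!ps. is_blocks ps \<and> index_of_blocks ps = k"
  using ex_blocks[OF assms] blocks_unique by blast

definition J :: "nat \<Rightarrow> nat \<Rightarrow> nat list set" where
  "J e r = {es. length es = r \<and> sum_list es = e}"

text \<open>List positions are counted from \<open>0\<close>, so the Kronecker deltas single out \<open>i = 0\<close> and
  \<open>i = length k - 1\<close>. For an index \<open>k\<close>, the subtraction truncates only in the case of \<open>-1\<close> over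
  \<open>0\<close>, where it yields \<open>0 choose 0 = 1\<close>; this agrees with the convention that \<open>e - 1\<close> over \<open>e\<close>
  is \<open>1\<close> for \<open>e = 0\<close> and \<open>0\<close> for \<open>e > 0\<close>.\<close>

definition b_coeff :: "nat list \<Rightarrow> nat list \<Rightarrow> nat" where
  "b_coeff k es = (\<Prod>i<length k.
     (k ! i + es ! i + of_bool (i = 0) + of_bool (i = length k - 1) - 2) choose (es ! i))"

definition q_int :: "real \<Rightarrow> nat \<Rightarrow> real" where
  "q_int q m = (1 - q ^ m) / (1 - q)"

definition q_fact :: "real \<Rightarrow> nat \<Rightarrow> real" where
  "q_fact q m = (\<Prod>a=1..m. q_int q a)"

text \<open>Intended for \<open>m \<le> N\<close> only.\<close>

definition q_binomial :: "real \<Rightarrow> nat \<Rightarrow> nat \<Rightarrow> real" where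
  "q_binomial q N m = q_fact q N / (q_fact q m * q_fact q (N - m))"

text \<open>The summation range \<open>1 \<le> m\<^sub>1 \<le> \<dots> \<le> m\<^sub>r \<le> N\<close>; for \<open>r = 0\<close> it contains exactly the empty
  tuple, so that \<open>z_star\<close> of the empty index is \<open>1\<close>.\<close>

definition chains :: "nat \<Rightarrow> nat \<Rightarrow> nat list set" where
  "chains N r = {ms. length ms = r \<and> sorted ms \<and> set ms \<subseteq> {1..N}}"

definition H_star :: "nat \<Rightarrow> nat list \<Rightarrow> real \<Rightarrow> real" where
  "H_star N k q = (\<Sum>ms\<in>chains N (length k).
     q ^ (\<Sum>i<length k. (k ! i - 1) * ms ! i) / (\<Prod>i<length k. q_int q (ms ! i) ^ (k ! i))
     * (- 1) ^ (last ms - 1) * q ^ (last ms * (last ms + 1) div 2) * q_binomial q N (last ms))"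

definition z_star :: "nat \<Rightarrow> nat list \<Rightarrow> nat list \<Rightarrow> real \<Rightarrow> real" where
  "z_star N k es q = (\<Sum>ms\<in>chains N (length k).
     q ^ (\<Sum>i<length k. (es ! i + 1) * ms ! i)
     / (\<Prod>i<length k. q_int q (ms ! i) ^ (k ! i + es ! i)))"

definition z_star0 :: "nat \<Rightarrow> nat list \<Rightarrow> real \<Rightarrow> real" where
  "z_star0 N k q = z_star N k (replicate (length k) 0) q"

end

theory Submission
  imports Defs "HOL-Computational_Algebra.Formal_Power_Series"
begin

text \<open>
  Both sides are the coefficients of \<open>X\<^sup>e\<close> in a power series, and the identity between the
  series is proved for all upper bounds \<open>N\<close> at once, by induction on the weight of \<open>k\<close>.

  Write \<open>[m]\<close> for the \<open>q\<close>-integer, \<open>b\<^sub>m = [m] - q\<^sup>m X\<close> and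
  \<open>P\<^sub>N = \<Prod>\<^sub>m\<^sub>\<le>\<^sub>N [m] / b\<^sub>m\<close>. Since \<open>[m] / b\<^sub>m\<close> is a geometric series, its powers have binomial
  coefficients, and summing over all \<open>e\<close> turns the binomials of the coefficient \<open>b(k; e)\<close> into
  the factors \<open>(1 / [m]) (q\<^sup>m / b\<^sub>m)\<^bsup>k\<^sub>i - 1\<^esup>\<close> at \<open>m = m\<^sub>i\<close>, with one more factor
  \<open>[m] / b\<^sub>m\<close> at each end of the chain; these two factors are what the Kronecker deltas stand for.
  On the other side the factors are \<open>(q\<^sup>m / b\<^sub>m) (1 / [m])\<^bsup>l\<^sub>i - 1\<^esup>\<close>, where \<open>l\<close> is the
  dual of \<open>k\<close>, and the sums \<open>z\<^sub>N({1}\<^sup>n)\<close>, being complete homogeneous symmetric functions, are the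
  coefficients of \<open>P\<^sub>N\<close>.

  Let \<open>v\<^sub>N(m)\<close> be the alternating weight \<open>(-1)\<^bsup>m-1\<^esup> q\<^bsup>m(m-1)/2\<^esup>\<close> times the \<open>q\<close>-binomial
  coefficient of \<open>N\<close> over \<open>m\<close>, and consider the transform \<open>T\<^sub>N h = \<Sum>\<^sub>m\<^sub>\<le>\<^sub>N v\<^sub>N(m) h(m)\<close>.
  Let \<open>g\<^sub>l(m)\<close> be the part of the right-hand nested sum with largest entry \<open>m\<close>, without the factor
  \<open>q\<^sup>m / b\<^sub>m\<close> of that entry, and let \<open>h\<^sub>k(m)\<close> be the same part of the left-hand one, without the
  factor \<open>q\<^sup>m / b\<^sub>m\<close> and the weight \<open>v\<^sub>N(m)\<close>. The heart of the
  proof is \<open>T\<^sub>N h\<^sub>k = P\<^sub>N g\<^sub>l(N)\<close> (\<open>transform_H_inner\<close>). An index and its dual are built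
  simultaneously from \<open>(1), (1)\<close> by two moves (\<open>hoffman_dual_induct\<close>): increasing the last entry
  of one while appending \<open>1\<close> to the other. Increasing the last entry multiplies \<open>h\<^sub>k(m)\<close> by
  \<open>q\<^sup>m / b\<^sub>m\<close> or \<open>g\<^sub>l(m)\<close> by \<open>1 / [m]\<close>; appending \<open>1\<close> replaces them by the partial sums of
  \<open>h\<^sub>k(n) / [n]\<close> or of \<open>g\<^sub>l(n) q\<^sup>n / b\<^sub>n\<close>. The transform exchanges
  multiplication and summation (\<open>transform_multiply\<close> and \<open>transform_partial_sum\<close>), so the
  induction goes through; it starts with \<open>transform_geo\<close>. A last application of
  \<open>transform_multiply\<close> supplies the remaining factors at the top of the chains.
\<close>

section \<open>Building an index together with its Hoffman dual\<close>

lemma index_of_blocks_snoc: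
  "index_of_blocks (ps @ [(a, b)]) =
     concat (map (\<lambda>(a', b'). replicate (a' - 1) 1 @ [b' + 1]) ps) @ replicate (a - 1) 1 @ [b]"
proof (induction ps)
  case Nil
  then show ?case by simp
next
  case (Cons p ps)
  then show ?case by (cases p; cases "ps @ [(a, b)]") auto
qed

lemma dual_of_blocks_snoc:
  "dual_of_blocks (ps @ [(a, b)]) =
     dual_of_blocks ps @ (if ps = [] then a else Suc a) # replicate (b - 1) 1"
  by (cases ps rule: dual_of_blocks.cases) auto

lemma dual_of_blocks_nonempty: "ps \<noteq> [] \<Longrightarrow> dual_of_blocks ps \<noteq> []"
  by (cases ps rule: dual_of_blocks.cases) auto

text \<open>The blocks are filled one unit at a time: the last block starts as \<open>(1, 1)\<close>, its first
  component grows while the second is still \<open>1\<close>, which lengthens the index, and then its second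
  component grows, which lengthens the dual. A new block \<open>(1, 1)\<close> arises by splitting
  \<open>(a', b' + 1)\<close> into \<open>(a', b'), (1, 1)\<close>, which again appends \<open>1\<close> to the index.\<close>

lemma blocks_induct:
  assumes blocks: "is_blocks ps"
    and single: "P [1] [1]"
    and incr: "\<And>k a l. 0 < a \<Longrightarrow> l \<noteq> [] \<Longrightarrow> P (k @ [a]) l \<Longrightarrow> P (k @ [Suc a]) (l @ [1])"
    and append: "\<And>k l b. 0 < b \<Longrightarrow> k \<noteq> [] \<Longrightarrow> P k (l @ [b]) \<Longrightarrow> P (k @ [1]) (l @ [Suc b])"
  shows "P (index_of_blocks ps) (dual_of_blocks ps)"
proof -
  let ?Q = "\<lambda>ps. P (index_of_blocks ps) (dual_of_blocks ps)"
  have grow: "?Q (ps @ [(Suc a, Suc b)])" if start: "?Q (ps @ [(1, 1)])" for ps a b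
  proof -
    have first: "?Q (ps @ [(Suc a, 1)])"
    proof (induction a)
      case 0
      then show ?case using start by simp
    next
      case (Suc a)
      have "P (index_of_blocks (ps @ [(Suc a, 1)]) @ [1])
              (dual_of_blocks ps @ [Suc (if ps = [] then Suc a else Suc (Suc a))])"
        using Suc by (intro append) (simp_all add: index_of_blocks_snoc dual_of_blocks_snoc)
      moreover have "index_of_blocks (ps @ [(Suc a, 1)]) @ [1] = index_of_blocks (ps @ [(Suc (Suc a), 1)])"
        by (simp add: index_of_blocks_snoc replicate_app_Cons_same)
      ultimately show ?case by (simp add: dual_of_blocks_snoc split: if_splits)
    qed
    show ?thesis
    proof (induction b)
      case 0
      then show ?case using first by simp
    next
      case (Suc b)
      let ?k = "concat (map (\<lambda>(a', b'). replicate (a' - 1) 1 @ [b' + 1]) ps) @ replicate a 1"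
      have "P (?k @ [Suc (Suc b)]) (dual_of_blocks (ps @ [(Suc a, Suc b)]) @ [1])"
        using Suc by (intro incr) (simp_all add: index_of_blocks_snoc dual_of_blocks_nonempty)
      then show ?case
        by (simp add: index_of_blocks_snoc dual_of_blocks_snoc replicate_append_same
            flip: replicate_Suc)
    qed
  qed
  have "\<forall>(a, b)\<in>set (ps @ [(c, d)]). 0 < a \<and> 0 < b \<Longrightarrow> ?Q (ps @ [(c, d)])" for ps c d
  proof (induction ps arbitrary: c d rule: rev_induct)
    case Nil
    then show ?case using grow[of "[]" "c - 1" "d - 1"] single by simp
  next
    case (snoc p ps)
    obtain a b where p: "p = (a, b)" by (cases p)
    have pos: "0 < a" "0 < b" "0 < c" "0 < d" using snoc.prems p by auto
    let ?x = "if ps = [] then a else Suc a"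
    have "?Q (ps @ [(a, Suc b)])" by (rule snoc.IH) (use snoc.prems p in auto)
    then have "P (index_of_blocks (ps @ [(a, Suc b)]))
                 ((dual_of_blocks ps @ ?x # replicate (b - 1) 1) @ [1])"
      using pos by (simp add: dual_of_blocks_snoc replicate_append_same flip: replicate_Suc)
    then have "P (index_of_blocks (ps @ [(a, Suc b)]) @ [1])
                 ((dual_of_blocks ps @ ?x # replicate (b - 1) 1) @ [Suc 1])"
      by (intro append) (simp_all add: index_of_blocks_snoc)
    moreover have "index_of_blocks (ps @ [(a, Suc b)]) @ [1] = index_of_blocks ((ps @ [p]) @ [(1, 1)])"
      by (simp only: index_of_blocks_snoc p) simp
    moreover have "(dual_of_blocks ps @ ?x # replicate (b - 1) 1) @ [Suc 1] = dual_of_blocks ((ps @ [p]) @ [(1, 1)])"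
      by (simp only: dual_of_blocks_snoc p) simp
    ultimately have "?Q ((ps @ [p]) @ [(1, 1)])" by simp
    from grow[OF this, of "c - 1" "d - 1"] show ?case using pos by simp
  qed
  moreover obtain qs c d where "ps = qs @ [(c, d)]"
    using blocks by (cases ps rule: rev_cases) (auto simp: is_blocks_def)
  ultimately show ?thesis using blocks by (auto simp: is_blocks_def)
qed

lemma hoffman_dual_induct [consumes 2, case_names single incr append]:
  assumes "is_index k" "k \<noteq> []"
    and "P [1] [1]"
    and "\<And>k a l. 0 < a \<Longrightarrow> l \<noteq> [] \<Longrightarrow> P (k @ [a]) l \<Longrightarrow> P (k @ [Suc a]) (l @ [1])"
    and "\<And>k l b. 0 < b \<Longrightarrow> k \<noteq> [] \<Longrightarrow> P k (l @ [b]) \<Longrightarrow> P (k @ [1]) (l @ [Suc b])"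
  shows "P k (hoffman_dual k)"
proof -
  let ?ps = "THE ps. is_blocks ps \<and> index_of_blocks ps = k"
  have ps: "is_blocks ?ps" "index_of_blocks ?ps = k"
    using theI'[OF ex1_blocks[OF assms(1,2)]] by auto
  have "P (index_of_blocks ?ps) (dual_of_blocks ?ps)"
    using assms(3-5) by (rule blocks_induct[OF ps(1)])
  then show ?thesis using ps(2) by (simp add: hoffman_dual_def)
qed

lemma is_index_hoffman_dual:
  assumes "is_index k" "k \<noteq> []"
  shows "is_index (hoffman_dual k) \<and> hoffman_dual k \<noteq> []"
  using assms by (induction rule: hoffman_dual_induct) (auto simp: is_index_def)

section \<open>Nested sums over chains\<close>

primrec star_sum :: "(nat \<Rightarrow> nat \<Rightarrow> 'a::comm_ring_1) \<Rightarrow> nat \<Rightarrow> nat \<Rightarrow> 'a" where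
  "star_sum F 0 N = 1"
| "star_sum F (Suc r) N = (\<Sum>m=1..N. star_sum F r m * F r m)"

lemma star_sum_cong:
  "(\<And>i m. i < r \<Longrightarrow> F i m = G i m) \<Longrightarrow> star_sum F r N = star_sum G r N"
  by (induction r arbitrary: N) auto

lemma finite_chains: "finite (chains N r)"
proof (rule finite_subset)
  show "chains N r \<subseteq> {ms. set ms \<subseteq> {1..N} \<and> length ms = r}" by (auto simp: chains_def)
qed (rule finite_lists_length_eq, simp)

lemma sum_chains_Suc:
  "sum G (chains N (Suc r)) = (\<Sum>m=1..N. \<Sum>ms\<in>chains m r. G (ms @ [m]))"
proof -
  have snoc: "\<exists>m xs. ms = xs @ [m] \<and> m \<in> {1..N} \<and> xs \<in> chains m r" if ms: "ms \<in> chains N (Suc r)" for ms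
  proof -
    obtain xs x where "ms = xs @ [x]"
      using ms by (cases ms rule: rev_cases) (auto simp: chains_def)
    then show ?thesis
      using ms by (fastforce simp: chains_def sorted_append)
  qed
  have chain: "ms @ [m] \<in> chains N (Suc r)" if "m \<in> {1..N}" "ms \<in> chains m r" for m ms
    using that by (force simp: chains_def sorted_append)
  have "sum G (chains N (Suc r)) = (\<Sum>(m, ms)\<in>Sigma {1..N} (\<lambda>m. chains m r). G (ms @ [m]))"
    by (rule sum.reindex_bij_witness[where j = "\<lambda>ms. (last ms, butlast ms)"
          and i = "\<lambda>(m, ms). ms @ [m]"]) (auto dest!: snoc intro: chain)
  then show ?thesis by (simp add: sum.Sigma finite_chains)
qed

lemma sum_chains_eq_star_sum:
  "(\<Sum>ms\<in>chains N r. \<Prod>i<r. F i (ms ! i)) = star_sum F r N"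
proof (induction r arbitrary: N)
  case 0
  have "chains N 0 = {[]}" by (auto simp: chains_def)
  then show ?case by simp
next
  case (Suc r)
  have "(\<Sum>ms\<in>chains m r. \<Prod>i<Suc r. F i ((ms @ [m]) ! i)) = star_sum F r m * F r m" for m
  proof -
    have "(\<Prod>i<Suc r. F i ((ms @ [m]) ! i)) = (\<Prod>i<r. F i (ms ! i)) * F r m"
      if "ms \<in> chains m r" for ms
      using that by (auto simp: chains_def nth_append intro!: prod.cong)
    then show ?thesis by (simp add: Suc flip: sum_distrib_right)
  qed
  then show ?case by (simp add: sum_chains_Suc)
qed

lemma fps_const_sum: "fps_const (\<Sum>x\<in>A. f x) = (\<Sum>x\<in>A. fps_const (f x))"
  by (induction A rule: infinite_finite_induct) (simp_all flip: fps_const_add)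

lemma coeff_prod_eq_sum_J:
  fixes F :: "nat \<Rightarrow> 'a::comm_ring_1 fps"
  shows "fps_nth (\<Prod>i<r. F i) e = (\<Sum>es\<in>J e r. \<Prod>i<r. fps_nth (F i) (es ! i))"
proof (cases r)
  case 0
  have "J e 0 = (if e = 0 then {[]} else {})" by (auto simp: J_def)
  then show ?thesis using 0 by simp
next
  case (Suc r')
  then show ?thesis
    using fps_prod_nth[of F r' e]
    by (simp add: J_def natpermute_def lessThan_Suc_atMost atLeast0AtMost)
qed

section \<open>The weights of the alternating sums\<close>

text \<open>The weight of \<open>H_star\<close> at its largest entry \<open>m\<close>, up to a factor \<open>q\<^sup>m\<close>, which is split off
  because it belongs to the multiplier of \<open>transform_multiply\<close>.\<close>

definition alt_weight :: "real \<Rightarrow> nat \<Rightarrow> nat \<Rightarrow> real" where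
  "alt_weight q N m = (- 1) ^ (m - 1) * q ^ (m * (m - 1) div 2) * q_binomial q N m"

context
  fixes q :: real
  assumes q_pos: "0 < q" and q_less: "q < 1"
begin

lemma q_int_pos: "0 < m \<Longrightarrow> 0 < q_int q m"
  using q_pos q_less by (simp add: q_int_def power_less_one_iff)

lemma q_int_neq_0: "0 < m \<Longrightarrow> q_int q m \<noteq> 0"
  using q_int_pos[of m] by simp

lemma q_int_1: "q_int q (Suc 0) = 1"
  using q_less by (simp add: q_int_def)

lemma q_int_diff: "m \<le> N \<Longrightarrow> q_int q N = q_int q (N - m) + q ^ (N - m) * q_int q m"
  using q_less by (simp add: q_int_def field_simps flip: power_add)

lemma q_fact_Suc: "q_fact q (Suc m) = q_int q (Suc m) * q_fact q m"
  by (simp add: q_fact_def)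

lemma q_fact_neq_0: "q_fact q m \<noteq> 0"
  by (induction m) (simp_all add: q_fact_Suc q_int_neq_0, simp add: q_fact_def)

lemma alt_weight_self: "alt_weight q N N = (- 1) ^ (N - 1) * q ^ (N * (N - 1) div 2)"
  using q_fact_neq_0[of N] by (simp add: alt_weight_def q_binomial_def q_fact_def)

lemma alt_weight_lower:
  assumes "m \<le> N"
  shows "q_int q (Suc N - m) * alt_weight q (Suc N) m = q_int q (Suc N) * alt_weight q N m"
proof -
  have "q_fact q (Suc N - m) = q_int q (Suc N - m) * q_fact q (N - m)"
    using assms by (simp add: Suc_diff_le q_fact_Suc)
  then show ?thesis
    using q_fact_neq_0 q_int_neq_0[of "Suc N - m"] assms
    by (simp add: alt_weight_def q_binomial_def q_fact_Suc)
qed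

lemma alt_weight_Suc:
  assumes "0 < m" "m < N"
  shows "q_int q (Suc m) * alt_weight q N (Suc m) = - (q ^ m * q_int q (N - m) * alt_weight q N m)"
proof -
  have lower: "q_fact q (N - m) = q_int q (N - m) * q_fact q (N - Suc m)"
    using assms q_fact_Suc[of "N - Suc m"] by (simp add: Suc_diff_Suc)
  obtain m' where m': "m = Suc m'" using assms by (cases m) auto
  have "Suc m * m div 2 = m + m * (m - 1) div 2"
  proof -
    have "Suc m * m = m * (m - 1) + m * 2" using m' by (simp add: algebra_simps)
    then show ?thesis by (simp only: div_mult_self1)
  qed
  then show ?thesis
    using q_fact_neq_0 q_int_neq_0[of "Suc m"] q_int_neq_0[of "N - m"] assms(2) m'
    by (simp add: alt_weight_def q_binomial_def q_fact_Suc lower[unfolded m'] power_add field_simps)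
qed

text \<open>The tail sums telescope: by \<open>alt_weight_Suc\<close>, the term at \<open>n\<close> is the difference of the
  closed forms at \<open>n\<close> and \<open>n + 1\<close>.\<close>

lemma alt_weight_tail_sum:
  assumes "0 < n" "n \<le> N"
  shows "(\<Sum>m=n..N. alt_weight q N m) = q_int q n / q_int q N * alt_weight q N n"
  using assms(2,1)
proof (induction n rule: inc_induct)
  case base
  then show ?case using q_int_neq_0[of N] by simp
next
  case (step n)
  have "(\<Sum>m=n..N. alt_weight q N m) =
      alt_weight q N n + q_int q (Suc n) * alt_weight q N (Suc n) / q_int q N"
    using step by (simp add: sum.atLeast_Suc_atMost)
  also have "\<dots> = (q_int q N - q ^ n * q_int q (N - n)) / q_int q N * alt_weight q N n"
    using step q_int_neq_0[of N] by (simp add: alt_weight_Suc field_simps)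
  also have "q_int q N - q ^ n * q_int q (N - n) = q_int q n"
    using step q_int_diff[of "N - n" N] by simp
  finally show ?case .
qed

section \<open>Generating functions\<close>

text \<open>The series of \<open>[m] / ([m] - q\<^sup>m X)\<close>, of \<open>1 / ([m] - q\<^sup>m X)\<close> and of the product of the
  former over \<open>m \<le> N\<close>.\<close>

definition geo :: "nat \<Rightarrow> real fps" where
  "geo m = Abs_fps (\<lambda>e. (q ^ m / q_int q m) ^ e)"

definition recip :: "nat \<Rightarrow> real fps" where
  "recip m = fps_const (1 / q_int q m) * geo m"

definition geo_prod :: "nat \<Rightarrow> real fps" where
  "geo_prod N = (\<Prod>m=1..N. geo m)"

lemma geo_inverse: "(1 - fps_const (q ^ m / q_int q m) * fps_X) * geo m = 1"
proof (rule fps_ext)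
  fix n
  show "fps_nth ((1 - fps_const (q ^ m / q_int q m) * fps_X) * geo m) n = fps_nth 1 n"
    by (cases n) (simp_all add: geo_def algebra_simps)
qed

lemma geo_eq: "0 < m \<Longrightarrow> geo m = fps_const (q_int q m) * recip m"
  by (simp add: recip_def q_int_neq_0 flip: mult.assoc)

lemma recip_inverse:
  assumes "0 < m"
  shows "(fps_const (q_int q m) - fps_const (q ^ m) * fps_X) * recip m = 1"
proof -
  have "fps_const (q_int q m) - fps_const (q ^ m) * fps_X
      = fps_const (q_int q m) * (1 - fps_const (q ^ m / q_int q m) * fps_X)"
    using q_int_neq_0[OF assms] by (simp add: right_diff_distrib flip: mult.assoc)
  also have "\<dots> * recip m = (1 - fps_const (q ^ m / q_int q m) * fps_X) * geo m"
    using geo_eq[OF assms] by (simp add: mult_ac)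
  finally show ?thesis by (simp add: geo_inverse)
qed

lemma geo_prod_Suc: "geo_prod (Suc N) = geo_prod N * geo (Suc N)"
  by (simp add: geo_prod_def)

text \<open>The truncated subtraction makes the binomial coefficient for \<open>n = 0\<close> equal to \<open>1\<close> at
  \<open>e = 0\<close> and \<open>0\<close> elsewhere, as it has to be; this is the convention used in \<open>b_coeff\<close>. The
  step is Pascal's rule, read off from \<open>(1 - t X) geo\<^bsup>n+1\<^esup> = geo\<^sup>n\<close>.\<close>

lemma geo_power_nth:
  "fps_nth (geo m ^ n) e = real ((n + e - 1) choose e) * (q ^ m / q_int q m) ^ e"
proof (induction n arbitrary: e)
  case 0
  then show ?case by (cases e) auto
next
  case (Suc n)
  note IH = Suc.IH
  let ?t = "q ^ m / q_int q m"
  have "geo m ^ n = (1 - fps_const ?t * fps_X) * geo m ^ Suc n"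
    by (simp add: geo_inverse flip: mult.assoc)
  then have *: "geo m ^ Suc n = geo m ^ n + fps_const ?t * (fps_X * geo m ^ Suc n)"
    by (simp add: algebra_simps)
  show ?case
  proof (induction e)
    case 0
    then show ?case by (simp add: geo_def fps_nth_power_0)
  next
    case (Suc e)
    have "fps_nth (geo m ^ Suc n) (Suc e) = fps_nth (geo m ^ n) (Suc e) + ?t * fps_nth (geo m ^ Suc n) e"
      by (subst *) (simp del: power_Suc)
    also have "\<dots> = (real ((n + e) choose Suc e) + real ((n + e) choose e)) * ?t ^ Suc e"
      by (simp only: Suc.IH IH) (simp add: algebra_simps add_divide_distrib)
    finally show ?case by (simp add: algebra_simps)
  qed
qed

section \<open>The transform exchanging the two kinds of nested sums\<close>

definition transform :: "nat \<Rightarrow> (nat \<Rightarrow> real fps) \<Rightarrow> real fps" where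
  "transform N h = (\<Sum>m=1..N. fps_const (alt_weight q N m) * h m)"

text \<open>Writing \<open>G\<^sub>N\<close> for the left-hand side, the identity
  \<open>b\<^sub>N = [N - m] + q\<^bsup>N-m\<^esup> b\<^sub>m\<close> and \<open>[N - m] v\<^sub>N(m) = [N] v\<^sub>N\<^sub>-\<^sub>1(m)\<close> give the recurrence
  \<open>b\<^sub>N G\<^sub>N = [N] G\<^sub>N\<^sub>-\<^sub>1 + q\<^sup>N T\<^sub>N h\<close>. Since \<open>b\<^sub>N P\<^sub>N = [N] P\<^sub>N\<^sub>-\<^sub>1\<close>, it says that
  \<open>G\<^sub>N / P\<^sub>N\<close> grows by \<open>q\<^sup>N g(N) / b\<^sub>N\<close> from \<open>N - 1\<close> to \<open>N\<close>.\<close>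

lemma transform_multiply:
  assumes "\<And>n. 1 \<le> n \<Longrightarrow> n \<le> N \<Longrightarrow> transform n h = geo_prod n * g n"
  shows "transform N (\<lambda>m. fps_const (q ^ m) * recip m * h m)
       = geo_prod N * (\<Sum>n=1..N. fps_const (q ^ n) * recip n * g n)"
  using assms
proof (induction N)
  case 0
  then show ?case by (simp add: transform_def)
next
  case (Suc N)
  let ?h = "\<lambda>m. fps_const (q ^ m) * recip m * h m"
  let ?b = "\<lambda>m. fps_const (q_int q m) - fps_const (q ^ m) * fps_X"
  let ?M = "Suc N"
  have "?b ?M * (fps_const (alt_weight q ?M m) * ?h m)
      = fps_const (q_int q (?M - m) * alt_weight q ?M m) * ?h m
        + fps_const (q ^ ?M) * (fps_const (alt_weight q ?M m) * h m)" if m: "m \<in> {1..?M}" for m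
  proof -
    have "q_int q ?M = q_int q (?M - m) + q ^ (?M - m) * q_int q m" "q ^ ?M = q ^ (?M - m) * q ^ m"
      using m by (auto intro: q_int_diff simp del: power_Suc simp flip: power_add)
    then have "?b ?M = fps_const (q_int q (?M - m)) + fps_const (q ^ (?M - m)) * ?b m"
      by (simp only: right_diff_distrib add_diff_eq mult.assoc flip: fps_const_add fps_const_mult)
    then have "?b ?M * (fps_const (alt_weight q ?M m) * ?h m)
      = fps_const (q_int q (?M - m)) * (fps_const (alt_weight q ?M m) * ?h m)
       + (fps_const (q ^ (?M - m)) * fps_const (q ^ m)) * (?b m * recip m) * (fps_const (alt_weight q ?M m) * h m)"
      by (simp only:) (simp only: algebra_simps)
    also have "fps_const (q ^ (?M - m)) * fps_const (q ^ m) = fps_const (q ^ ?M)"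
      using m by (simp del: power_Suc flip: power_add)
    also have "?b m * recip m = 1" using m by (intro recip_inverse) simp
    finally show ?thesis by (simp add: mult.assoc flip: fps_const_mult)
  qed
  then have "?b ?M * transform ?M ?h
      = (\<Sum>m=1..?M. fps_const (q_int q (?M - m) * alt_weight q ?M m) * ?h m)
        + fps_const (q ^ ?M) * transform ?M h"
    by (simp only: transform_def sum_distrib_left sum.distrib[symmetric] cong: sum.cong)
  also have "(\<Sum>m=1..?M. fps_const (q_int q (?M - m) * alt_weight q ?M m) * ?h m)
      = (\<Sum>m=1..N. fps_const (q_int q ?M * alt_weight q N m) * ?h m)"
    by (simp add: q_int_def[of q 0] alt_weight_lower)
  also have "\<dots> = fps_const (q_int q ?M) * transform N ?h"
    by (simp add: transform_def sum_distrib_left mult.assoc flip: fps_const_mult)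
  also have "transform N ?h = geo_prod N * (\<Sum>n=1..N. fps_const (q ^ n) * recip n * g n)"
    using Suc by simp
  also have "transform ?M h = geo_prod ?M * g ?M"
    using Suc.prems by simp
  finally have step: "?b ?M * transform ?M ?h =
      fps_const (q_int q ?M) * (geo_prod N * (\<Sum>n=1..N. fps_const (q ^ n) * recip n * g n))
      + fps_const (q ^ ?M) * (geo_prod ?M * g ?M)" .
  have "transform ?M ?h = ?b ?M * recip ?M * transform ?M ?h"
    using recip_inverse[of ?M] by simp
  also have "\<dots> = recip ?M * (?b ?M * transform ?M ?h)"
    by (simp only: mult_ac)
  also have "\<dots> = geo_prod N * (fps_const (q_int q ?M) * recip ?M) * (\<Sum>n=1..N. fps_const (q ^ n) * recip n * g n)
      + geo_prod ?M * (fps_const (q ^ ?M) * recip ?M * g ?M)"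
    by (simp only: step) (simp only: algebra_simps)
  also have "geo_prod N * (fps_const (q_int q ?M) * recip ?M) = geo_prod ?M"
    by (simp add: geo_prod_Suc geo_eq)
  finally show ?case by (simp add: distrib_left)
qed

text \<open>After exchanging the summations, the coefficient of \<open>h n / [n]\<close> is a tail sum of the
  weights, which is \<open>[n] / [N]\<close> times the weight at \<open>n\<close>.\<close>

lemma transform_partial_sum:
  assumes "0 < N"
  shows "transform N (\<lambda>m. \<Sum>n=1..m. fps_const (1 / q_int q n) * h n)
       = fps_const (1 / q_int q N) * transform N h"
proof -
  let ?c = "\<lambda>n. fps_const (1 / q_int q n)"
  have "transform N (\<lambda>m. \<Sum>n=1..m. ?c n * h n)
      = (\<Sum>m=1..N. \<Sum>n=1..m. fps_const (alt_weight q N m) * (?c n * h n))"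
    by (simp add: transform_def sum_distrib_left)
  also have "\<dots> = (\<Sum>n=1..N. \<Sum>m=n..N. fps_const (alt_weight q N m) * (?c n * h n))"
    unfolding sum.Sigma[OF finite_atLeastAtMost ballI[OF finite_atLeastAtMost]]
    by (rule sum.reindex_bij_witness[where i = prod.swap and j = prod.swap]) auto
  also have "\<dots> = (\<Sum>n=1..N. fps_const (\<Sum>m=n..N. alt_weight q N m) * (?c n * h n))"
    by (simp add: sum_distrib_right fps_const_sum)
  also have "\<dots> = (\<Sum>n=1..N. ?c N * (fps_const (alt_weight q N n) * h n))"
  proof (rule sum.cong[OF refl])
    fix n assume n: "n \<in> {1..N}"
    then have "(\<Sum>m=n..N. alt_weight q N m) * (1 / q_int q n) = 1 / q_int q N * alt_weight q N n"
      using q_int_neq_0[of n] by (simp add: alt_weight_tail_sum)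
    then show "fps_const (\<Sum>m=n..N. alt_weight q N m) * (?c n * h n)
        = ?c N * (fps_const (alt_weight q N n) * h n)"
      by (simp only: mult.assoc[symmetric] fps_const_mult)
  qed
  finally show ?thesis by (simp add: transform_def sum_distrib_left)
qed

text \<open>Factoring \<open>geo m\<close> as \<open>(q\<^sup>m / b\<^sub>m) ([m] / q\<^sup>m)\<close> reduces the claim to
  \<open>transform_multiply\<close>: the transform of \<open>[m] / q\<^sup>m\<close> is \<open>1 / q\<close> for \<open>n = 1\<close> and vanishes for all
  larger \<open>n\<close>, so that a single summand remains.\<close>

lemma transform_geo:
  assumes "0 < N"
  shows "transform N geo = geo_prod N"
proof -
  let ?h = "\<lambda>m. fps_const (q_int q m / q ^ m)"
  \<comment> \<open>As \<open>geo_prod 1 = 1 / b\<^sub>1\<close>, this is the transform of \<open>?h\<close> divided by \<open>geo_prod n\<close>.\<close>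
  let ?g = "\<lambda>n::nat. if n = 1 then fps_const (1 / q) * (fps_const (q_int q 1) - fps_const (q ^ 1) * fps_X) else 0"
  have base: "transform n ?h = geo_prod n * ?g n" if n: "1 \<le> n" "n \<le> N" for n
  proof (cases "n = 1")
    case True
    have "geo_prod 1 = recip 1" by (simp add: geo_prod_def geo_eq q_int_1)
    moreover have "recip 1 * (fps_const (q_int q 1) - fps_const (q ^ 1) * fps_X) = 1"
      using recip_inverse[of 1] by (simp add: mult.commute)
    ultimately have "geo_prod 1 * ?g 1 = fps_const (1 / q)"
      by (simp add: mult.left_commute)
    moreover have "transform 1 ?h = fps_const (1 / q)"
      using alt_weight_self[of 1] by (simp add: transform_def q_int_1)
    ultimately show ?thesis using True by simp
  next
    case False
    obtain n' where n': "n = Suc n'" "0 < n'" using False n by (cases n) auto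
    \<comment> \<open>The terms from \<open>m = 2\<close> on reduce to the weights for \<open>n - 1\<close>, and their sum cancels
      the first term.\<close>
    have "alt_weight q n (Suc m) * (q_int q (Suc m) / q ^ Suc m) = - (q_int q n / q * alt_weight q n' m)"
      if "m \<in> {1..n'}" for m
    proof -
      have "q_int q (Suc m) * alt_weight q n (Suc m) = - (q ^ m * (q_int q n * alt_weight q n' m))"
        using that alt_weight_Suc[of m n] alt_weight_lower[of m n'] n' by (simp add: mult.assoc)
      then show ?thesis using q_pos by (simp add: field_simps)
    qed
    then have "(\<Sum>m=1..n'. alt_weight q n (Suc m) * (q_int q (Suc m) / q ^ Suc m))
        = - (q_int q n / q * (\<Sum>m=1..n'. alt_weight q n' m))"
      by (simp only: sum_negf sum_distrib_left cong: sum.cong)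
    also have "\<dots> = - (q_int q n / q_int q n' * alt_weight q n' 1 / q)"
      using alt_weight_tail_sum[of 1 n'] n' by (simp add: q_int_1)
    also have "q_int q n / q_int q n' * alt_weight q n' 1 = alt_weight q n 1"
      using alt_weight_lower[of 1 n'] n' q_int_neq_0[of n'] by (simp add: field_simps)
    finally have "(\<Sum>m=1..n. alt_weight q n m * (q_int q m / q ^ m)) = 0"
      unfolding n'(1)
      by (subst sum.atLeast_Suc_atMost, simp, subst sum.shift_bounds_cl_Suc_ivl) (simp add: q_int_1)
    then have "fps_const (\<Sum>m=1..n. alt_weight q n m * (q_int q m / q ^ m)) = 0" by simp
    then show ?thesis using False by (simp add: transform_def fps_const_sum)
  qed
  have "geo m = fps_const (q ^ m) * recip m * ?h m" if "m \<in> {1..N}" for m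
  proof -
    have "fps_const (q ^ m) * recip m * ?h m = fps_const (q ^ m) * ?h m * recip m"
      by (simp only: mult_ac)
    then show ?thesis using that q_pos by (simp add: geo_eq)
  qed
  then have "transform N geo = transform N (\<lambda>m. fps_const (q ^ m) * recip m * ?h m)"
    by (simp only: transform_def cong: sum.cong)
  also have "\<dots> = geo_prod N * (\<Sum>n=1..N. fps_const (q ^ n) * recip n * ?g n)"
    by (rule transform_multiply[OF base])
  also have "(\<Sum>n=1..N. fps_const (q ^ n) * recip n * ?g n) = fps_const (q ^ 1) * recip 1 * ?g 1"
    using assms by (subst sum.remove[of _ 1]) auto
  also have "\<dots> = (fps_const q * fps_const (1 / q)) * ((fps_const (q_int q 1) - fps_const (q ^ 1) * fps_X) * recip 1)"
    by (simp add: mult_ac)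
  also have "\<dots> = 1"
    using recip_inverse[of 1] q_pos by simp
  finally show ?thesis by simp
qed

section \<open>Duality of the inner sums\<close>

text \<open>The inner sums are the nested sums with the largest entry fixed to be \<open>m\<close>. In \<open>H_inner\<close> the
  last factor is multiplied by \<open>[m]\<close> and in \<open>z_inner\<close> it lacks \<open>q\<^sup>m / b\<^sub>m\<close>, so that an
  appended entry \<open>1\<close> contributes the factor \<open>1\<close>, which gives the moves of \<open>hoffman_dual_induct\<close> the same
  form on both sides.\<close>

definition H_factor :: "nat list \<Rightarrow> nat \<Rightarrow> nat \<Rightarrow> real fps" where
  "H_factor k i m = fps_const (1 / q_int q m) * (fps_const (q ^ m) * recip m) ^ (k ! i - 1)
     * (if i = 0 then geo m else 1)"

definition H_inner :: "nat list \<Rightarrow> nat \<Rightarrow> real fps" where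
  "H_inner k m = star_sum (H_factor k) (length k - 1) m
     * (fps_const (q_int q m) * H_factor k (length k - 1) m)"

definition z_factor :: "nat list \<Rightarrow> nat \<Rightarrow> nat \<Rightarrow> real fps" where
  "z_factor l i m = fps_const (q ^ m) * recip m * fps_const (1 / q_int q m) ^ (l ! i - 1)"

definition z_inner :: "nat list \<Rightarrow> nat \<Rightarrow> real fps" where
  "z_inner l m = star_sum (z_factor l) (length l - 1) m
     * fps_const (1 / q_int q m) ^ (last l - 1)"

lemma star_sum_H_factor_snoc:
  "star_sum (H_factor (k @ [a])) (length k) m = star_sum (H_factor k) (length k) m"
  by (rule star_sum_cong) (simp add: H_factor_def nth_append)

lemma star_sum_z_factor_snoc:
  "star_sum (z_factor (l @ [b])) (length l) m = star_sum (z_factor l) (length l) m"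
  by (rule star_sum_cong) (simp add: z_factor_def nth_append)

lemma H_inner_snoc_Suc:
  assumes "0 < a"
  shows "H_inner (k @ [Suc a]) m = fps_const (q ^ m) * recip m * H_inner (k @ [a]) m"
proof -
  obtain a' where a': "a = Suc a'" using assms by (cases a) auto
  have "H_factor (k @ [Suc a]) (length k) m = fps_const (q ^ m) * recip m * H_factor (k @ [a]) (length k) m"
    unfolding H_factor_def a' nth_append_length diff_Suc_1 power_Suc by (simp only: mult_ac)
  then show ?thesis
    by (simp only: H_inner_def length_append_singleton diff_Suc_1 star_sum_H_factor_snoc mult_ac)
qed

lemma z_inner_snoc_Suc:
  assumes "0 < b"
  shows "z_inner (l @ [Suc b]) m = fps_const (1 / q_int q m) * z_inner (l @ [b]) m"
proof -
  obtain b' where b': "b = Suc b'" using assms by (cases b) auto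
  show ?thesis
    unfolding z_inner_def b' length_append_singleton diff_Suc_1 star_sum_z_factor_snoc last_snoc power_Suc
    by (simp only: mult_ac)
qed

lemma H_inner_snoc_1:
  assumes "k \<noteq> []" "0 < m"
  shows "H_inner (k @ [1]) m = (\<Sum>n=1..m. fps_const (1 / q_int q n) * H_inner k n)"
proof -
  obtain r where r: "length k = Suc r" using assms by (cases k) auto
  have "H_inner (k @ [1]) m = star_sum (H_factor k) (length k) m * (fps_const (q_int q m) * H_factor (k @ [1]) (length k) m)"
    by (simp only: H_inner_def length_append_singleton diff_Suc_1 star_sum_H_factor_snoc)
  also have "fps_const (q_int q m) * H_factor (k @ [1]) (length k) m = 1"
    using assms q_int_neq_0[of m] by (simp add: H_factor_def)
  also have "star_sum (H_factor k) (length k) m = (\<Sum>n=1..m. fps_const (1 / q_int q n) * H_inner k n)"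
    unfolding r star_sum.simps
  proof (rule sum.cong[OF refl])
    fix n assume "n \<in> {1..m}"
    then have one: "fps_const (1 / q_int q n) * fps_const (q_int q n) = 1"
      using q_int_neq_0[of n] by simp
    have "fps_const (1 / q_int q n) * H_inner k n
        = (fps_const (1 / q_int q n) * fps_const (q_int q n)) * (star_sum (H_factor k) r n * H_factor k r n)"
      unfolding H_inner_def r diff_Suc_1 by (simp only: mult_ac)
    then show "star_sum (H_factor k) r n * H_factor k r n = fps_const (1 / q_int q n) * H_inner k n"
      by (simp only: one mult_1)
  qed
  finally show ?thesis by simp
qed

lemma star_sum_z_factor:
  assumes "l \<noteq> []"
  shows "star_sum (z_factor l) (length l) m = (\<Sum>n=1..m. fps_const (q ^ n) * recip n * z_inner l n)"
proof -
  obtain l' b where l: "l = l' @ [b]" using assms by (cases l rule: rev_cases) auto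
  show ?thesis
    unfolding z_inner_def l length_append_singleton star_sum.simps diff_Suc_1 last_snoc
    unfolding z_factor_def[of "l' @ [b]" "length l'"] nth_append_length
    by (simp only: mult_ac)
qed

lemma z_inner_snoc_1:
  assumes "l \<noteq> []"
  shows "z_inner (l @ [1]) m = (\<Sum>n=1..m. fps_const (q ^ n) * recip n * z_inner l n)"
  using star_sum_z_factor[OF assms] by (simp add: z_inner_def star_sum_z_factor_snoc)

lemma transform_cong:
  "(\<And>m. 0 < m \<Longrightarrow> h m = h' m) \<Longrightarrow> transform N h = transform N h'"
  by (simp add: transform_def)

text \<open>The upper bound is quantified inside the induction because \<open>transform_multiply\<close>
  needs the hypothesis for all smaller bounds.\<close>

lemma transform_H_inner:
  assumes "is_index k" "k \<noteq> []"
  shows "\<forall>N>0. transform N (H_inner k) = geo_prod N * z_inner (hoffman_dual k) N"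
  using assms
proof (induction rule: hoffman_dual_induct)
  case single
  have "H_inner [1] m = geo m" if "0 < m" for m
    using that q_int_neq_0[of m] by (simp add: H_inner_def H_factor_def flip: mult.assoc)
  then have "transform N (H_inner [1]) = transform N geo" for N
    by (rule transform_cong)
  then show ?case by (simp add: transform_geo z_inner_def)
next
  case (incr k a l)
  have "transform N (H_inner (k @ [Suc a])) = geo_prod N * z_inner (l @ [1]) N" for N
  proof -
    have "transform N (H_inner (k @ [Suc a]))
        = transform N (\<lambda>m. fps_const (q ^ m) * recip m * H_inner (k @ [a]) m)"
      using incr by (intro transform_cong H_inner_snoc_Suc)
    also have "\<dots> = geo_prod N * (\<Sum>n=1..N. fps_const (q ^ n) * recip n * z_inner l n)"
      by (rule transform_multiply) (use incr in simp)
    finally show ?thesis using incr by (simp add: z_inner_snoc_1 del: One_nat_def)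
  qed
  then show ?case by blast
next
  case (append k l b)
  have "transform N (H_inner (k @ [1])) = geo_prod N * z_inner (l @ [Suc b]) N" if "0 < N" for N
  proof -
    have "transform N (H_inner (k @ [1]))
        = transform N (\<lambda>m. \<Sum>n=1..m. fps_const (1 / q_int q n) * H_inner k n)"
      using append by (intro transform_cong H_inner_snoc_1)
    also have "\<dots> = fps_const (1 / q_int q N) * transform N (H_inner k)"
      using that by (rule transform_partial_sum)
    also have "transform N (H_inner k) = geo_prod N * z_inner (l @ [b]) N"
      using append that by blast
    also have "fps_const (1 / q_int q N) * (geo_prod N * z_inner (l @ [b]) N)
        = geo_prod N * z_inner (l @ [Suc b]) N"
      by (simp only: z_inner_snoc_Suc[OF \<open>0 < b\<close>] mult_ac)
    finally show ?thesis .
  qed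
  then show ?case by blast
qed

section \<open>Reading off coefficients\<close>

text \<open>The coefficients of the product are complete homogeneous symmetric functions. In the recurrence
  from \<open>(1 - t X) geo_prod (N + 1) = geo_prod N\<close>, the two terms are the chains whose largest entry
  is below \<open>N + 1\<close> and those that end with \<open>N + 1\<close>.\<close>

lemma geo_prod_nth:
  "fps_nth (geo_prod N) n = star_sum (\<lambda>_ m. q ^ m / q_int q m) n N"
proof (induction N arbitrary: n)
  case 0
  then show ?case by (cases n) (simp_all add: geo_prod_def)
next
  case (Suc N)
  note IH = Suc.IH
  let ?t = "q ^ Suc N / q_int q (Suc N)"
  have "geo_prod N = (1 - fps_const ?t * fps_X) * geo (Suc N) * geo_prod N"
    by (simp only: geo_inverse mult_1)
  then have "geo_prod N = (1 - fps_const ?t * fps_X) * geo_prod (Suc N)"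
    by (simp only: geo_prod_Suc mult_ac)
  then have *: "geo_prod (Suc N) = geo_prod N + fps_const ?t * (fps_X * geo_prod (Suc N))"
    by (simp add: algebra_simps)
  show ?case
  proof (induction n)
    case 0
    have "fps_nth (geo_prod (Suc N)) 0 = fps_nth (geo_prod N) 0"
      by (subst *) simp
    then show ?case by (simp add: IH)
  next
    case (Suc n)
    have "fps_nth (geo_prod (Suc N)) (Suc n) = fps_nth (geo_prod N) (Suc n) + ?t * fps_nth (geo_prod (Suc N)) n"
      by (subst *) (simp del: power_Suc)
    then show ?case by (simp add: IH Suc.IH del: power_Suc)
  qed
qed

lemma z_star0_ones: "z_star0 N (replicate n 1) q = fps_nth (geo_prod N) n"
proof -
  have "z_star0 N (replicate n 1) q = (\<Sum>ms\<in>chains N n. \<Prod>i<n. q ^ (ms ! i) / q_int q (ms ! i))"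
    by (simp add: z_star0_def z_star_def power_sum prod_dividef)
  then show ?thesis
    by (simp only: geo_prod_nth sum_chains_eq_star_sum[of "\<lambda>_ m. q ^ m / q_int q m"])
qed

lemma chains_pos: "ms \<in> chains N r \<Longrightarrow> i < r \<Longrightarrow> 0 < ms ! i"
  using subsetD[OF _ nth_mem, of ms "{1..N}" i] by (auto simp: chains_def)

lemma z_factor_nth:
  assumes "0 < l ! i"
  shows "fps_nth (z_factor l i m) e = q ^ ((e + 1) * m) / q_int q m ^ (l ! i + e)"
proof -
  obtain d where d: "l ! i = Suc d" using assms by (cases "l ! i") auto
  have "z_factor l i m = fps_const (q ^ m / q_int q m ^ Suc d) * geo m"
    by (simp add: z_factor_def recip_def d power_one_over mult_ac flip: mult.assoc)
  then show ?thesis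
    by (simp add: geo_def d power_divide power_add add_mult_distrib mult.commute[of e] power_mult)
qed

lemma star_sum_z_factor_nth:
  assumes "is_index l"
  shows "fps_nth (star_sum (z_factor l) (length l) N) j = (\<Sum>es\<in>J j (length l). z_star N l es q)"
proof -
  have pos: "0 < l ! i" if "i < length l" for i
    using that assms nth_mem by (auto simp: is_index_def)
  have "fps_nth (star_sum (z_factor l) (length l) N) j
      = (\<Sum>ms\<in>chains N (length l). fps_nth (\<Prod>i<length l. z_factor l i (ms ! i)) j)"
    by (simp add: fps_sum_nth flip: sum_chains_eq_star_sum)
  also have "\<dots> = (\<Sum>ms\<in>chains N (length l). \<Sum>es\<in>J j (length l).
      \<Prod>i<length l. q ^ ((es ! i + 1) * ms ! i) / q_int q (ms ! i) ^ (l ! i + es ! i))"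
    by (simp add: coeff_prod_eq_sum_J z_factor_nth pos)
  also have "\<dots> = (\<Sum>es\<in>J j (length l). z_star N l es q)"
    by (subst sum.swap) (simp add: z_star_def power_sum prod_dividef)
  finally show ?thesis .
qed

text \<open>The deltas count the extra factors \<open>geo m\<close>: one comes from the first position and one from
  the last, and both from the only position of an index of depth \<open>1\<close>.\<close>

lemma H_factor_nth:
  assumes "0 < m" "0 < k ! i" "i < length k"
  shows "fps_nth (H_factor k i m * (if i = length k - 1 then geo m else 1)) e
       = real ((k ! i + e + of_bool (i = 0) + of_bool (i = length k - 1) - 2) choose e)
         * (q ^ ((k ! i + e - 1) * m) / q_int q m ^ (k ! i + e))"
proof -
  obtain d where d: "k ! i = Suc d" using assms by (cases "k ! i") auto
  let ?n = "d + of_bool (i = 0) + of_bool (i = length k - 1)"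
  have "H_factor k i m * (if i = length k - 1 then geo m else 1)
      = fps_const (1 / q_int q m) * fps_const (q ^ m / q_int q m) ^ d * geo m ^ ?n"
  proof -
    have "fps_const (q ^ m) * recip m = fps_const (q ^ m / q_int q m) * geo m"
      by (simp add: recip_def flip: mult.assoc)
    then show ?thesis
      by (simp add: H_factor_def d power_add power_mult_distrib mult.assoc del: fps_const_power fps_const_mult)
  qed
  then have "fps_nth (H_factor k i m * (if i = length k - 1 then geo m else 1)) e
      = (1 / q_int q m) * (q ^ m / q_int q m) ^ d * (real ((?n + e - 1) choose e) * (q ^ m / q_int q m) ^ e)"
    by (simp only: fps_const_power fps_const_mult fps_mult_left_const_nth geo_power_nth)
  also have "?n + e - 1 = k ! i + e + of_bool (i = 0) + of_bool (i = length k - 1) - 2"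
    by (simp add: d)
  also have "(1 / q_int q m) * (q ^ m / q_int q m) ^ d * (c * (q ^ m / q_int q m) ^ e)
      = c * (q ^ ((k ! i + e - 1) * m) / q_int q m ^ (k ! i + e))" for c
    by (simp add: d power_divide power_add add_mult_distrib mult.commute[of _ m] power_mult
        mult.left_commute[of c])
  finally show ?thesis .
qed

text \<open>At the top of the chain, the multiplier \<open>q\<^sup>m / b\<^sub>m\<close> and the factor \<open>[m]\<close> of \<open>H_inner\<close>
  combine to the extra \<open>geo m\<close> of the last position and the factor \<open>q\<^sup>m\<close> that completes the weight
  of \<open>H_star\<close>.\<close>

lemma transform_H_inner_nth:
  assumes "is_index k" "k \<noteq> []"
  shows "fps_nth (transform N (\<lambda>m. fps_const (q ^ m) * recip m * H_inner k m)) e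
       = (\<Sum>es\<in>J e (length k). real (b_coeff k es) * H_star N (map2 (+) k es) q)"
proof -
  obtain r where r: "length k = Suc r" using assms by (cases k) auto
  let ?w = "\<lambda>m. q ^ m * alt_weight q N m"
  define A where "A i m = H_factor k i m * (if i = length k - 1 then geo m else 1)" for i m
  define F where "F i m = A i m * (if i = r then fps_const (?w m) else 1)" for i m
  have pos: "0 < k ! i" if "i < length k" for i
    using that assms nth_mem by (auto simp: is_index_def)
  have A_nth: "fps_nth (A i m) e = real ((k ! i + e + of_bool (i = 0) + of_bool (i = length k - 1) - 2) choose e)
         * (q ^ ((k ! i + e - 1) * m) / q_int q m ^ (k ! i + e))" if "0 < m" "i < length k" for i m e
    unfolding A_def using that pos by (intro H_factor_nth) auto
  have "transform N (\<lambda>m. fps_const (q ^ m) * recip m * H_inner k m) = star_sum F (Suc r) N"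
    unfolding transform_def star_sum.simps
  proof (rule sum.cong[OF refl])
    fix m assume "m \<in> {1..N}"
    have "star_sum F r m = star_sum (H_factor k) r m"
      by (rule star_sum_cong) (simp add: F_def A_def r)
    moreover have "F r m = H_factor k r m * (fps_const (q_int q m) * recip m) * (fps_const (q ^ m) * fps_const (alt_weight q N m))"
      using \<open>m \<in> {1..N}\<close> by (simp add: F_def A_def r geo_eq)
    ultimately show "fps_const (alt_weight q N m) * (fps_const (q ^ m) * recip m * H_inner k m) = star_sum F r m * F r m"
      unfolding H_inner_def r diff_Suc_1 by (simp only: mult_ac)
  qed
  also have "\<dots> = (\<Sum>ms\<in>chains N (Suc r). \<Prod>i<Suc r. F i (ms ! i))"
    by (rule sum_chains_eq_star_sum[symmetric])
  also have "\<dots> = (\<Sum>ms\<in>chains N (Suc r). (\<Prod>i<Suc r. A i (ms ! i)) * fps_const (?w (ms ! r)))"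
    by (simp add: F_def mult.assoc)
  finally have "fps_nth (transform N (\<lambda>m. fps_const (q ^ m) * recip m * H_inner k m)) e
      = (\<Sum>ms\<in>chains N (Suc r). \<Sum>es\<in>J e (Suc r). (\<Prod>i<Suc r. fps_nth (A i (ms ! i)) (es ! i)) * ?w (ms ! r))"
    by (simp only: fps_sum_nth fps_mult_right_const_nth coeff_prod_eq_sum_J sum_distrib_right)
  also have "\<dots> = (\<Sum>es\<in>J e (Suc r). \<Sum>ms\<in>chains N (Suc r). (\<Prod>i<Suc r. fps_nth (A i (ms ! i)) (es ! i)) * ?w (ms ! r))"
    by (rule sum.swap)
  also have "\<dots> = (\<Sum>es\<in>J e (Suc r). real (b_coeff k es) * H_star N (map2 (+) k es) q)"
  proof (rule sum.cong[OF refl])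
    fix es assume "es \<in> J e (Suc r)"
    then have es: "length es = Suc r" by (simp add: J_def)
    let ?k = "map2 (+) k es"
    have len: "length ?k = Suc r" using es r by simp
    have nth: "?k ! i = k ! i + es ! i" if "i < Suc r" for i
      using that es r by simp
    have "(\<Prod>i<Suc r. fps_nth (A i (ms ! i)) (es ! i)) * ?w (ms ! r)
        = real (b_coeff k es) * (q ^ (\<Sum>i<length ?k. (?k ! i - 1) * ms ! i) / (\<Prod>i<length ?k. q_int q (ms ! i) ^ (?k ! i))
     * (- 1) ^ (last ms - 1) * q ^ (last ms * (last ms + 1) div 2) * q_binomial q N (last ms))"
      if ms: "ms \<in> chains N (Suc r)" for ms
    proof -
      have last: "last ms = ms ! r"
        using ms by (subst last_conv_nth) (auto simp: chains_def)
      have "(\<Prod>i<Suc r. fps_nth (A i (ms ! i)) (es ! i))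
          = (\<Prod>i<Suc r. real ((k ! i + es ! i + of_bool (i = 0) + of_bool (i = length k - 1) - 2) choose (es ! i))
             * (q ^ ((?k ! i - 1) * ms ! i) / q_int q (ms ! i) ^ (?k ! i)))"
        by (rule prod.cong[OF refl]) (use ms r chains_pos nth A_nth in simp)
      also have "\<dots> = real (b_coeff k es) * (q ^ (\<Sum>i<length ?k. (?k ! i - 1) * ms ! i) / (\<Prod>i<length ?k. q_int q (ms ! i) ^ (?k ! i)))"
        unfolding len by (simp only: b_coeff_def r prod.distrib prod_dividef power_sum of_nat_prod)
      finally have prod: "(\<Prod>i<Suc r. fps_nth (A i (ms ! i)) (es ! i)) = \<dots>" .
      have "?w (last ms) = (- 1) ^ (last ms - 1) * q ^ (last ms * (last ms + 1) div 2) * q_binomial q N (last ms)"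
      proof -
        have "last ms * (last ms + 1) = last ms * (last ms - 1) + last ms * 2"
          by (cases "last ms") (simp_all add: algebra_simps)
        then have "last ms * (last ms + 1) div 2 = last ms + last ms * (last ms - 1) div 2"
          by (simp only: div_mult_self1)
        then show ?thesis by (simp add: alt_weight_def power_add)
      qed
      then show ?thesis unfolding prod last by (simp only: mult.assoc)
    qed
    then show "(\<Sum>ms\<in>chains N (Suc r). (\<Prod>i<Suc r. fps_nth (A i (ms ! i)) (es ! i)) * ?w (ms ! r))
        = real (b_coeff k es) * H_star N ?k q"
      unfolding H_star_def sum_distrib_left len by (rule sum.cong[OF refl])
  qed
  finally show ?thesis by (simp only: r)
qed

end

theorem theorem2p1:
  fixes q :: real and N e r s :: nat and k :: "nat list"
  assumes "0 < q" and "q < 1"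
    and "0 < N"
    and "0 < r"
    and "is_index k" and "length k = r"
    and "s = length (hoffman_dual k)"
  shows "(\<Sum>es\<in>J e r. real (b_coeff k es) * H_star N (map2 (+) k es) q)
       = (\<Sum>j=0..e. z_star0 N (replicate (e - j) 1) q * (\<Sum>es'\<in>J j s. z_star N (hoffman_dual k) es' q))"
proof -
  note q = assms(1,2)
  have k: "is_index k" "k \<noteq> []" using assms by auto
  let ?l = "hoffman_dual k"
  have l: "is_index ?l" "?l \<noteq> []" using is_index_hoffman_dual[OF k] by auto
  have "transform q N (\<lambda>m. fps_const (q ^ m) * recip q m * H_inner q k m)
      = geo_prod q N * (\<Sum>n=1..N. fps_const (q ^ n) * recip q n * z_inner q ?l n)"
    by (rule transform_multiply[OF q]) (use transform_H_inner[OF q k] in simp)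
  also have "\<dots> = star_sum (z_factor q ?l) s N * geo_prod q N"
    by (simp only: star_sum_z_factor[OF q l(2)] assms(7) mult.commute)
  finally have "fps_nth (transform q N (\<lambda>m. fps_const (q ^ m) * recip q m * H_inner q k m)) e
      = (\<Sum>j=0..e. fps_nth (star_sum (z_factor q ?l) s N) j * fps_nth (geo_prod q N) (e - j))"
    by (simp only: fps_mult_nth)
  then show ?thesis
    using transform_H_inner_nth[OF q k] star_sum_z_factor_nth[OF q l(1)] z_star0_ones[OF q] assms(6,7)
    by (simp add: mult.commute del: replicate_eq_replicate)
qed

end
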